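(* Let $\operatorname{Core}(z,w)=\sum_{G}w^{m(G)}\frac{z^{n(G)}}{n(G)!}$ be the generating function of cores, i.e. simple graphs (labelled vertices, unlabelled unoriented edges, no loops or multiple edges) with minimum degree at least $2$, where $n(G)$ and $m(G)$ are the numbers of vertices and edges. Then \[ \operatorname{Core}(z,w)=\sum_{m\ge 0}(2m)!\,[x^{2m}]\,P(ze^x,w,-1)\,e^{z(e^x-1-x)}\,\frac{w^m}{2^m m!}, \] where $P(z,w,u)$ is the patchwork generating function.
   Context: A multigraph $G$ is a pair $(V(G),E(G))$ with $V(G)$ a finite set of labelled vertices and $E(G)$ a set of labelled edges (edge labels independent of vertex labels); each edge is a triple $(v,w,e)$ with $v,w\in V(G)$ (possibly equal) and $e$ its label. $n(G)=|V(G)|$, $m(G)=|E(G)|$, excess $k(G)=m(G)-n(G)$. A loop of $G$ is a subgraph $(\{v\},\{(v,v,e)\})$; a double edge of $G$ is a subgraph $(\{v,w\},\{e_1,e_2\})$ with $v\neq w$ and $e_1,e_2$ two distinct edges of $G$ each joining $v$ and $w$ (either orientation). A patchwork is a finite set $P=\{(V_1,E_1),\dots,(V_p,E_p)\}$ such that $\operatorname{MG}(P)=(\bigcup V_i,\bigcup E_i)$ is a multigraph and each $(V_i,E_i)$ is a loop or a double edge of $\operatorname{MG}(P)$; $|P|=p$, and $n(P),m(P)$ are the numbers of vertices and edges of $\operatorname{MG}(P)$. Labelled objects are counted up to increasing relabelling. The patchwork generating function is $P(z,w,u)=\sum_{P}u^{|P|}\frac{w^{m(P)}}{2^{m(P)}m(P)!}\frac{z^{n(P)}}{n(P)!}$.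 $[x^j]F(x)$ denotes the coefficient of $x^j$. *)

theory Defs
  imports "HOL-Computational_Algebra.Computational_Algebra"
begin

text \<open>
  An edge is a triple (start, end, label). Loops and parallel edges are allowed; edges are
  oriented and distinguished by their labels.
\<close>

type_synonym ('v, 'e) mgraph = "'v set \<times> ('v \<times> 'v \<times> 'e) set"

definition edge_label :: "'v \<times> 'v \<times> 'e \<Rightarrow> 'e" where
  "edge_label = (\<lambda>(v, w, e). e)"

definition multigraph :: "('v, 'e) mgraph \<Rightarrow> bool" where
  "multigraph G \<longleftrightarrow>
     finite (fst G) \<and> finite (snd G) \<and>
     (\<forall>(v, w, e) \<in> snd G. v \<in> fst G \<and> w \<in> fst G) \<and>
     inj_on edge_label (snd G)"

definition is_loop :: "('v, 'e) mgraph \<Rightarrow> ('v, 'e) mgraph \<Rightarrow> bool" where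
  "is_loop G H \<longleftrightarrow>
     (\<exists>v e. v \<in> fst G \<and> (v, v, e) \<in> snd G \<and> H = ({v}, {(v, v, e)}))"

definition joins :: "'v \<times> 'v \<times> 'e \<Rightarrow> 'v \<Rightarrow> 'v \<Rightarrow> bool" where
  "joins a v w \<longleftrightarrow> (\<exists>e. a = (v, w, e) \<or> a = (w, v, e))"

definition is_double_edge :: "('v, 'e) mgraph \<Rightarrow> ('v, 'e) mgraph \<Rightarrow> bool" where
  "is_double_edge G H \<longleftrightarrow>
     (\<exists>v w a b. v \<in> fst G \<and> w \<in> fst G \<and> v \<noteq> w \<and>
        a \<in> snd G \<and> b \<in> snd G \<and> a \<noteq> b \<and> joins a v w \<and> joins b v w \<and>
        H = ({v, w}, {a, b}))"

definition MG :: "('v, 'e) mgraph set \<Rightarrow> ('v, 'e) mgraph" where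
  "MG P = (\<Union>(fst ` P), \<Union>(snd ` P))"

definition patchwork :: "('v, 'e) mgraph set \<Rightarrow> bool" where
  "patchwork P \<longleftrightarrow>
     finite P \<and> multigraph (MG P) \<and> (\<forall>H \<in> P. is_loop (MG P) H \<or> is_double_edge (MG P) H)"

text \<open>
  Every class of patchworks modulo increasing relabelling contains exactly one patchwork whose
  vertex labels are 1, ..., n and whose edge labels are 1, ..., m.
\<close>

definition patchworks :: "nat \<Rightarrow> nat \<Rightarrow> (nat, nat) mgraph set set" where
  "patchworks n m =
     {P. patchwork P \<and> fst (MG P) = {1..n} \<and> edge_label ` snd (MG P) = {1..m}}"

lemma finite_patchworks: "finite (patchworks n m)"
proof (rule finite_subset)
  let ?E = "{1..n} \<times> {1..n} \<times> {1..m}"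
  show "patchworks n m \<subseteq> Pow (Pow {1..n} \<times> Pow ?E)"
  proof
    fix P assume P: "P \<in> patchworks n m"
    have "snd (MG P) \<subseteq> ?E"
    proof
      fix a assume a: "a \<in> snd (MG P)"
      obtain v w e where a_eq: "a = (v, w, e)" by (cases a)
      have "e \<in> edge_label ` snd (MG P)"
        using a by (force simp: a_eq edge_label_def)
      then show "a \<in> ?E"
        using P a by (auto simp: patchworks_def patchwork_def multigraph_def a_eq)
    qed
    moreover have "fst (MG P) \<subseteq> {1..n}"
      using P by (simp add: patchworks_def)
    ultimately show "P \<in> Pow (Pow {1..n} \<times> Pow ?E)"
      by (fastforce simp: MG_def)
  qed
  show "finite (Pow (Pow {1..n} \<times> Pow ?E))"
    by simp
qed

type_synonym 'v sgraph = "'v set \<times> 'v set set"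

definition simple_graph :: "'v sgraph \<Rightarrow> bool" where
  "simple_graph G \<longleftrightarrow> finite (fst G) \<and> (\<forall>e \<in> snd G. e \<subseteq> fst G \<and> card e = 2)"

definition degree_of :: "'v sgraph \<Rightarrow> 'v \<Rightarrow> nat" where
  "degree_of G v = card {e \<in> snd G. v \<in> e}"

definition core :: "'v sgraph \<Rightarrow> bool" where
  "core G \<longleftrightarrow> simple_graph G \<and> (\<forall>v \<in> fst G. degree_of G v \<ge> 2)"

definition cores :: "nat \<Rightarrow> nat \<Rightarrow> nat sgraph set" where
  "cores n m = {G. core G \<and> fst G = {1..n} \<and> card (snd G) = m}"

lemma finite_cores: "finite (cores n m)"
proof (rule finite_subset)
  show "cores n m \<subseteq> {{1..n}} \<times> Pow (Pow {1..n})"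
    unfolding cores_def core_def simple_graph_def by fastforce
  show "finite ({{1..n}} \<times> Pow (Pow {1..n}))"
    by simp
qed

text \<open>
  Multivariate formal power series are iterated univariate ones. The outermost variable is
  always w, followed by z; in series that involve x, the variable x is the innermost one.
  In the patchwork generating function the coefficient of a monomial in w and z is a polynomial
  in u, so that numbers can be substituted for u.
\<close>

definition Core_gf :: "rat fps fps" where
  "Core_gf = Abs_fps (\<lambda>m. Abs_fps (\<lambda>n. \<Sum>G\<in>cores n m. 1 / fact n))"

definition Patchwork_gf :: "rat poly fps fps" where
  "Patchwork_gf = Abs_fps (\<lambda>m. Abs_fps (\<lambda>n.
     \<Sum>P\<in>patchworks n m. monom (1 / (2 ^ m * fact m * fact n)) (card P)))"

text \<open>
  Substitution of a series in z and x for z, and of a number for u, in a series in w, z and u.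
  The series substituted for z must have no constant term with respect to z.
\<close>

definition subst_zu :: "rat poly fps fps \<Rightarrow> rat fps fps \<Rightarrow> rat \<Rightarrow> rat fps fps fps" where
  "subst_zu F \<zeta> c =
     Abs_fps (\<lambda>m. Abs_fps (\<lambda>n. fps_const (poly (F $ m $ n) c)) oo \<zeta>)"

text \<open>
  The exponential of a series in z and x without constant term with respect to z. The
  exponential series of the library requires coefficients in a field, hence the explicit lift.
\<close>

definition exp_zx :: "rat fps fps \<Rightarrow> rat fps fps" where
  "exp_zx f = Abs_fps (\<lambda>n. fps_const (fps_exp 1 $ n)) oo f"

definition z_var :: "rat fps fps" where
  "z_var = fps_X"

definition e_x :: "rat fps fps" where
  "e_x = fps_const (fps_exp 1)"

definition x_var :: "rat fps fps" where
  "x_var = fps_const fps_X"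

definition coeff_x :: "nat \<Rightarrow> rat fps fps fps \<Rightarrow> rat fps fps" where
  "coeff_x j F = Abs_fps (\<lambda>m. Abs_fps (\<lambda>n. F $ m $ n $ j))"

end

theory Submission
  imports Defs
begin

text \<open>
  A simple graph with M edges corresponds to 2^M M! multigraphs with labelled, oriented edges.
  A multigraph is simple iff it has no patch (loop or double edge), so weighting every subset of
  its patches, i.e. every patchwork contained in it, by (-1) to the number of patches singles out
  the simple ones. Exchanging the sums, fix the patchwork first: its vertices have degree at least
  2 already, so the 2m half-edges of the remaining m edges are mapped to the vertices such that only
  the vertices outside the patchwork are required to be hit at least twice. Such maps are counted by
  (2m)! times the coefficient of x^(2m) in (e^x)^k (e^x - 1 - x)^(n - k), where k is the number of
  vertices of the patchwork.
\<close>

section \<open>Counting maps with prescribed fibre sizes\<close>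

text \<open>Patches may share vertices and edges, so different patchworks can have the same
  underlying multigraph. This is harmless: the number of ways to complete a patchwork depends only
  on the vertex set V and the label set E that it occupies, and the number of patches enters only
  through the sign. The shape of the formula comes from label bookkeeping. Choosing V among n
  vertices and E among M labels gives binomial coefficients, which split 1/n! and 1/(2^M M!) into a
  weight of the patchwork and a weight of the rest. The summation index m of the theorem therefore
  counts only the edges outside the patchwork. One factor e^x for each vertex of V is the effect of
  substituting z e^x for z; the other vertices form a set whose members carry e^x - 1 - x each,
  hence the exponential.\<close>

lemma sum_minus_one_power_card_Pow:
  fixes A :: "'a set"
  assumes "finite A"
  shows "(\<Sum>X\<in>Pow A. (-1) ^ card X :: 'b::comm_ring_1) = (if A = {} then 1 else 0)"
proof -
  have "(\<Sum>X\<in>Pow A. (-1) ^ card X :: 'b) = (\<Prod>x\<in>A. 1 - 1)"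
    using prod_diff_conv_sum[of A "\<lambda>_. 1 :: 'b" "\<lambda>_. 1"] assms by simp
  also have "\<dots> = (if A = {} then 1 else 0)"
    using assms by (simp add: power_0_left)
  finally show ?thesis .
qed

lemma sum_card_Pow:
  fixes f :: "nat \<Rightarrow> 'b::comm_semiring_1"
  assumes "finite A"
  shows "(\<Sum>X\<in>Pow A. f (card X)) = (\<Sum>i\<le>card A. of_nat (card A choose i) * f i)"
proof -
  have "(\<Sum>X\<in>Pow A. f (card X)) = (\<Sum>i\<le>card A. \<Sum>X\<in>{X \<in> Pow A. card X = i}. f (card X))"
    using assms by (intro sum.group[symmetric]) (auto intro: card_mono)
  also have "\<dots> = (\<Sum>i\<le>card A. of_nat (card A choose i) * f i)"
    using n_subsets[OF assms] by (intro sum.cong) simp_all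
  finally show ?thesis .
qed

text \<open>This is the product rule for exponential generating functions: a map distributes L over
  disjoint fibres, and each vertex contributes the series of its admissible fibre sizes. In the
  induction on V the fibre over the new vertex is removed from L, which is why L has to
  vary.\<close>

lemma card_prescribed_fibres:
  fixes T :: "'v \<Rightarrow> nat set"
  assumes "finite V" "finite L"
  shows "of_nat (card {f \<in> L \<rightarrow>\<^sub>E V. \<forall>v\<in>V. card {l \<in> L. f l = v} \<in> T v}) =
    fact (card L) *
      (\<Prod>v\<in>V. Abs_fps (\<lambda>i. if i \<in> T v then 1 / fact i else (0 :: 'a::field_char_0))) $ card L"
  using assms
proof (induction V arbitrary: L)
  case empty
  then show ?case by (cases "L = {}") (simp_all add: card_PiE card_gt_0_iff)
next
  case (insert a V L)
  define G where "G v = Abs_fps (\<lambda>i. if i \<in> T v then 1 / fact i else (0 :: 'a))" for v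
  define F where "F V L = {f \<in> L \<rightarrow>\<^sub>E V. \<forall>v\<in>V. card {l \<in> L. f l = v} \<in> T v}" for V and L :: "'b set"
  define \<S> where "\<S> = {S \<in> Pow L. card S \<in> T a}"
  have IH: "of_nat (card (F V (L - S))) = fact (card L - card S) * prod G V $ (card L - card S)"
    if "S \<subseteq> L" for S
    using insert.IH[of "L - S"] insert.prems that
    by (simp add: F_def G_def card_Diff_subset finite_subset)
  have finF: "finite (F V (L - S))" for S
    using insert by (simp add: F_def finite_PiE)
  let ?D = "\<lambda>f. {l \<in> L. f l = a}"
  let ?J = "\<lambda>f. (?D f, restrict f (L - ?D f))"
  let ?K = "\<lambda>(S, f) l. if l \<in> S then a else f l"
  \<comment> \<open>A map into \<open>insert a V\<close> amounts to its fibre over \<open>a\<close>,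
    any S of admissible size, together with a map from the remaining labels into V. As
    \<open>a\<close> is not in V, the fibres over V are untouched.\<close>
  have "bij_betw ?J (F (insert a V) L) (SIGMA S:\<S>. F V (L - S))"
  proof (rule bij_betw_byWitness[where f' = ?K])
    show "\<forall>f\<in>F (insert a V) L. ?K (?J f) = f"
    proof (intro ballI ext)
      fix f l assume "f \<in> F (insert a V) L"
      then have PiE: "f \<in> L \<rightarrow>\<^sub>E insert a V" by (simp add: F_def)
      show "?K (?J f) l = f l"
        using PiE_arb[OF PiE, of l] by (cases "l \<in> L") simp_all
    qed
    show "\<forall>p\<in>SIGMA S:\<S>. F V (L - S). ?J (?K p) = p"
    proof
      fix p assume "p \<in> (SIGMA S:\<S>. F V (L - S))"
      then obtain S f where p: "p = (S, f)" and S: "S \<subseteq> L" and f: "f \<in> F V (L - S)"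
        by (auto simp: \<S>_def)
      have PiE: "f \<in> (L - S) \<rightarrow>\<^sub>E V" using f by (simp add: F_def)
      have "f l \<noteq> a" if "l \<in> L" "l \<notin> S" for l
        using PiE_mem[OF PiE, of l] that insert.hyps(2) by auto
      then have D: "?D (?K (S, f)) = S"
        using S by auto
      have "restrict (?K (S, f)) (L - S) = f"
      proof
        fix l show "restrict (?K (S, f)) (L - S) l = f l"
          using PiE_arb[OF PiE, of l] by (cases "l \<in> L - S") simp_all
      qed
      then show "?J (?K p) = p"
        unfolding p D by simp
    qed
    show "?J ` F (insert a V) L \<subseteq> (SIGMA S:\<S>. F V (L - S))"
    proof (rule image_subsetI)
      fix f assume f: "f \<in> F (insert a V) L"
      then have PiE: "f \<in> L \<rightarrow>\<^sub>E insert a V" by (simp add: F_def)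
      have "?D f \<in> \<S>"
        using f by (simp add: F_def \<S>_def Collect_restrict)
      moreover have "restrict f (L - ?D f) \<in> F V (L - ?D f)"
      proof -
        have "restrict f (L - ?D f) \<in> (L - ?D f) \<rightarrow>\<^sub>E V"
          using PiE_mem[OF PiE] by (intro restrict_PiE_iff[THEN iffD2]) blast
        moreover have "card {l \<in> L - ?D f. restrict f (L - ?D f) l = v} \<in> T v" if v: "v \<in> V" for v
        proof -
          have "{l \<in> L - ?D f. restrict f (L - ?D f) l = v} = {l \<in> L. f l = v}"
            using v insert.hyps(2) by auto
          then show ?thesis using f v by (simp add: F_def)
        qed
        ultimately show ?thesis by (simp add: F_def)
      qed
      ultimately show "?J f \<in> (SIGMA S:\<S>. F V (L - S))" by (rule SigmaI)
    qed
    show "?K ` (SIGMA S:\<S>. F V (L - S)) \<subseteq> F (insert a V) L"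
    proof (rule image_subsetI)
      fix p assume "p \<in> (SIGMA S:\<S>. F V (L - S))"
      then obtain S f where p: "p = (S, f)" and S: "S \<subseteq> L" "card S \<in> T a" and f: "f \<in> F V (L - S)"
        by (auto simp: \<S>_def)
      have PiE: "f \<in> (L - S) \<rightarrow>\<^sub>E V" using f by (simp add: F_def)
      have "f l \<noteq> a" if "l \<in> L" "l \<notin> S" for l
        using PiE_mem[OF PiE, of l] that insert.hyps(2) by auto
      then have D: "?D (?K (S, f)) = S"
        using S(1) by auto
      have "card {l \<in> L. ?K (S, f) l = v} \<in> T v" if v: "v \<in> V" for v
      proof -
        have "{l \<in> L. ?K (S, f) l = v} = {l \<in> L - S. f l = v}"
          using v insert.hyps(2) by auto
        then show ?thesis using f v by (simp add: F_def)
      qed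
      moreover have "card (?D (?K (S, f))) \<in> T a"
        unfolding D by (rule S(2))
      moreover have "?K (S, f) \<in> L \<rightarrow>\<^sub>E insert a V"
      proof (rule PiE_I)
        fix l assume "l \<in> L"
        then show "?K (S, f) l \<in> insert a V" using PiE_mem[OF PiE, of l] by simp
      next
        fix l assume "l \<notin> L"
        then show "?K (S, f) l = undefined" using S(1) PiE_arb[OF PiE, of l] by auto
      qed
      ultimately show "?K p \<in> F (insert a V) L"
        unfolding F_def p by blast
    qed
  qed
  then have "card (F (insert a V) L) = card (SIGMA S:\<S>. F V (L - S))"
    by (rule bij_betw_same_card)
  also have "\<dots> = (\<Sum>S\<in>\<S>. card (F V (L - S)))"
    using insert.prems finF by (intro card_SigmaI) (auto simp: \<S>_def)
  finally have "of_nat (card (F (insert a V) L)) =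
      (\<Sum>S\<in>\<S>. fact (card L - card S) * prod G V $ (card L - card S))"
    by (simp add: IH \<S>_def)
  also have "\<dots> = (\<Sum>S\<in>Pow L. if card S \<in> T a
      then fact (card L - card S) * prod G V $ (card L - card S) else 0)"
    using insert.prems unfolding \<S>_def by (intro sum.inter_filter) simp
  also have "\<dots> = (\<Sum>i\<le>card L. of_nat (card L choose i) *
      (if i \<in> T a then fact (card L - i) * prod G V $ (card L - i) else 0))"
    by (rule sum_card_Pow) (rule insert.prems)
  \<comment> \<open>The identity (n choose i) (n - i)! = n! / i! turns the binomial sum into a
    Cauchy product; \<open>G a $ i\<close> supplies 1 / i! and vanishes for excluded sizes.\<close>
  also have "\<dots> = (\<Sum>i\<le>card L. fact (card L) * (G a $ i * prod G V $ (card L - i)))"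
    by (intro sum.cong) (simp_all add: G_def binomial_fact field_simps)
  also have "\<dots> = fact (card L) * (prod G (insert a V) $ card L)"
    using insert.hyps by (simp add: fps_mult_nth sum_distrib_left atLeast0AtMost)
  finally show ?case
    by (simp add: F_def G_def)
qed

text \<open>A vertex of V accepts every fibre size, with series e^x; a vertex outside V must avoid
  the sizes 0 and 1, which removes the terms 1 and x.\<close>

lemma card_min_degree_maps:
  assumes "finite N" "V \<subseteq> N" "finite L"
  shows "of_nat (card {f \<in> L \<rightarrow>\<^sub>E N. \<forall>v\<in>N - V. 2 \<le> card {l \<in> L. f l = v}}) =
    (fact (card L) *
      (fps_exp 1 ^ card V * (fps_exp 1 - 1 - fps_X) ^ (card N - card V)) $ card L :: 'a::field_char_0)"
proof -
  define T :: "_ \<Rightarrow> nat set" where "T v = {i. v \<in> V \<or> 2 \<le> i}" for v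
  define G where "G v = Abs_fps (\<lambda>i. if i \<in> T v then 1 / fact i else (0 :: 'a))" for v
  have "{f \<in> L \<rightarrow>\<^sub>E N. \<forall>v\<in>N - V. 2 \<le> card {l \<in> L. f l = v}} =
      {f \<in> L \<rightarrow>\<^sub>E N. \<forall>v\<in>N. card {l \<in> L. f l = v} \<in> T v}"
    using assms by (auto simp: T_def)
  moreover have "prod G N = prod G V * prod G (N - V)"
    using assms by (metis prod.subset_diff mult.commute)
  moreover have "prod G V = fps_exp 1 ^ card V"
    by (subst prod_constant[symmetric], rule prod.cong) (auto simp: G_def T_def fps_eq_iff)
  moreover have "prod G (N - V) = (fps_exp 1 - 1 - fps_X) ^ card (N - V)"
    by (subst prod_constant[symmetric], rule prod.cong)
      (auto simp: G_def T_def fps_eq_iff fps_X_def numeral_2_eq_2 not_less_eq_eq le_Suc_eq)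
  ultimately show ?thesis
    using card_prescribed_fibres[OF assms(1,3), of T, where ?'a = 'a] assms
    by (simp add: G_def card_Diff_subset finite_subset)
qed

section \<open>Patches and half-edges\<close>

text \<open>The ground set of the inclusion-exclusion: for a multigraph G, its subsets are exactly
  the patchworks contained in G.\<close>

definition patches :: "('v, 'e) mgraph \<Rightarrow> ('v, 'e) mgraph set" where
  "patches G = {H. is_loop G H \<or> is_double_edge G H}"

lemma patches_cases:
  assumes "H \<in> patches G"
  obtains (loop) v e where "v \<in> fst G" "(v, v, e) \<in> snd G" "H = ({v}, {(v, v, e)})"
  | (double) v w a b where "v \<in> fst G" "w \<in> fst G" "v \<noteq> w" "a \<in> snd G" "b \<in> snd G" "a \<noteq> b"
      "joins a v w" "joins b v w" "H = ({v, w}, {a, b})"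
proof -
  from assms consider "is_loop G H" | "is_double_edge G H"
    by (auto simp: patches_def)
  then show thesis
  proof cases
    case 1
    then show thesis unfolding is_loop_def by (elim exE conjE) (rule loop)
  next
    case 2
    then show thesis unfolding is_double_edge_def by (elim exE conjE) (rule double)
  qed
qed

lemma patch_subset:
  assumes "H \<in> patches G"
  shows "fst H \<subseteq> fst G" "snd H \<subseteq> snd G"
  using assms by (auto elim: patches_cases)

lemma patch_closed:
  assumes "H \<in> patches G" "(v, w, e) \<in> snd H"
  shows "v \<in> fst H \<and> w \<in> fst H"
  using assms by (auto elim!: patches_cases simp: joins_def)

text \<open>Apart from lying inside G, being a patch of G is a property of H alone. Hence patches
  can be moved between \<open>MG P\<close> and a larger multigraph.\<close>

lemma patches_local:
  assumes "H \<in> patches G" "fst H \<subseteq> fst G'" "snd H \<subseteq> snd G'"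
  shows "H \<in> patches G'"
  using assms(1)
proof (cases rule: patches_cases)
  case (loop v e)
  then show ?thesis using assms(2,3) by (auto simp: patches_def is_loop_def)
next
  case (double v w a b)
  then have "v \<in> fst G'" "w \<in> fst G'" "a \<in> snd G'" "b \<in> snd G'" using assms(2,3) by auto
  then have "is_double_edge G' H" using double unfolding is_double_edge_def by blast
  then show ?thesis by (simp add: patches_def)
qed

lemma finite_patches:
  assumes "multigraph G"
  shows "finite (patches G)"
proof (rule finite_subset)
  show "patches G \<subseteq> Pow (fst G) \<times> Pow (snd G)"
  proof
    fix H assume "H \<in> patches G"
    then show "H \<in> Pow (fst G) \<times> Pow (snd G)"
      using patch_subset[of H G] by (cases H) simp
  qed
  show "finite (Pow (fst G) \<times> Pow (snd G))"
    using assms by (simp add: multigraph_def)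
qed

lemma patchwork_altdef:
  "patchwork P \<longleftrightarrow> finite P \<and> multigraph (MG P) \<and> P \<subseteq> patches (MG P)"
  by (auto simp: patchwork_def patches_def)

lemma subset_MG:
  assumes "H \<in> P"
  shows "fst H \<subseteq> fst (MG P)" "snd H \<subseteq> snd (MG P)"
  using assms by (auto simp: MG_def)

text \<open>A patchwork is defined relative to its own multigraph \<open>MG P\<close>, whereas
  inclusion-exclusion runs over the subsets of the patches of a fixed G. Locality of patches
  reconciles the two, and \<open>MG P\<close> is a multigraph because each patch contains the ends
  of its edges.\<close>

lemma subset_patches_iff:
  assumes G: "multigraph G"
  shows "P \<subseteq> patches G \<longleftrightarrow>
    patchwork P \<and> fst (MG P) \<subseteq> fst G \<and> snd (MG P) \<subseteq> snd G"
proof (intro iffI conjI)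
  assume P: "P \<subseteq> patches G"
  show 1: "fst (MG P) \<subseteq> fst G" and 2: "snd (MG P) \<subseteq> snd G"
    using P by (auto simp: MG_def dest: subsetD[OF P, THEN patch_subset(1), THEN subsetD]
        subsetD[OF P, THEN patch_subset(2), THEN subsetD])
  have "v \<in> fst (MG P) \<and> w \<in> fst (MG P)" if vwe: "(v, w, e) \<in> snd (MG P)" for v w e
  proof -
    obtain H where H: "H \<in> P" "(v, w, e) \<in> snd H"
      using vwe unfolding MG_def snd_conv by blast
    then have "v \<in> fst H \<and> w \<in> fst H"
      using P by (intro patch_closed) auto
    then show ?thesis
      using subset_MG(1)[OF H(1)] by auto
  qed
  moreover have "finite (fst (MG P))" "finite (snd (MG P))" "inj_on edge_label (snd (MG P))"
    using G 1 2 by (auto simp: multigraph_def intro: finite_subset inj_on_subset)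
  ultimately have "multigraph (MG P)"
    by (auto simp: multigraph_def)
  moreover have "finite P"
    using P finite_patches[OF G] by (rule finite_subset)
  moreover have "P \<subseteq> patches (MG P)"
    using P patches_local[OF _ subset_MG] by blast
  ultimately show "patchwork P"
    by (simp add: patchwork_altdef)
next
  assume P: "patchwork P \<and> fst (MG P) \<subseteq> fst G \<and> snd (MG P) \<subseteq> snd G"
  show "P \<subseteq> patches G"
  proof
    fix H assume "H \<in> P"
    with P have "H \<in> patches (MG P)"
      by (auto simp: patchwork_altdef)
    then show "H \<in> patches G"
      using P subset_MG[OF \<open>H \<in> P\<close>] by (intro patches_local[of H "MG P" G]) auto
  qed
qed

text \<open>
  A multigraph with edge labels L is given by the end points \<^term>\<open>h\<close> of its half-edges, where
  (e, False) and (e, True) are the two halves of the edge with label e.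
\<close>

definition mg_edges :: "'e set \<Rightarrow> ('e \<times> bool \<Rightarrow> 'v) \<Rightarrow> ('v \<times> 'v \<times> 'e) set" where
  "mg_edges L h = (\<lambda>e. (h (e, False), h (e, True), e)) ` L"

lemma mem_mg_edges: "(v, w, e) \<in> mg_edges L h \<longleftrightarrow> e \<in> L \<and> v = h (e, False) \<and> w = h (e, True)"
  by (auto simp: mg_edges_def)

lemma mg_edges_subset_iff:
  "mg_edges E h' \<subseteq> mg_edges L h \<longleftrightarrow> E \<subseteq> L \<and> (\<forall>l\<in>E \<times> UNIV. h' l = h l)"
proof -
  have "(\<forall>l\<in>E \<times> UNIV. h' l = h l) \<longleftrightarrow> (\<forall>e\<in>E. h' (e, False) = h (e, False) \<and> h' (e, True) = h (e, True))"
    by (auto simp: all_bool_eq)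
  then show ?thesis
    by (fastforce simp: mg_edges_def)
qed

lemma multigraph_mg_edges:
  assumes "finite N" "finite L" "h \<in> L \<times> UNIV \<rightarrow> N"
  shows "multigraph (N, mg_edges L h)"
  using assms by (auto simp: multigraph_def mg_edges_def edge_label_def inj_on_def)

text \<open>Labels are injective on edges, so an edge can be looked up by its label and its two end
  points read off.\<close>

lemma multigraph_half_edges:
  assumes "multigraph G"
  obtains h where "mg_edges (edge_label ` snd G) h = snd G"
proof
  define a where "a = inv_into (snd G) edge_label"
  define h where "h = (\<lambda>(e, s). if s then fst (snd (a e)) else fst (a e))"
  have a: "a (edge_label x) = x" if "x \<in> snd G" for x
    using assms that by (simp add: a_def multigraph_def)
  show "mg_edges (edge_label ` snd G) h = snd G"
    unfolding mg_edges_def image_image h_def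
    by (rule trans[OF image_cong image_ident]) (auto simp: a, auto simp: edge_label_def)
qed

text \<open>In a loop both halves of one edge lie at v; in a double edge each of the two edges has a
  half at v. Either way two different half-edges end in v.\<close>

lemma degree_patchwork_vertex:
  assumes P: "patchwork P" and v: "v \<in> fst (MG P)"
    and sub: "snd (MG P) \<subseteq> mg_edges L h" and L: "finite L"
  shows "2 \<le> card {l \<in> L \<times> UNIV. h l = v}"
proof -
  have two: ?thesis
    if "e \<in> L" "e' \<in> L" "h (e, s) = v" "h (e', s') = v" "(e, s) \<noteq> (e', s')" for e e' s s'
  proof -
    have "card {(e, s), (e', s')} \<le> card {l \<in> L \<times> UNIV. h l = v}"
      using L that by (intro card_mono) simp_all
    then show ?thesis using that(5) by simp
  qed
  obtain H where H: "H \<in> P" "v \<in> fst H"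
    using v unfolding MG_def fst_conv by blast
  then have "H \<in> patches (MG P)" using P by (auto simp: patchwork_altdef)
  then show ?thesis
  proof (cases rule: patches_cases)
    case (loop u e)
    then have "v = u" using H(2) by simp
    then have "(v, v, e) \<in> mg_edges L h" using loop(2) sub by blast
    then have "e \<in> L" "h (e, False) = v" "h (e, True) = v"
      by (metis mem_mg_edges)+
    then show ?thesis
      by (intro two[of e e False True]) simp_all
  next
    case (double x y a b)
    have v: "v = x \<or> v = y" using H(2) double(9) by simp
    have half: "\<exists>e\<in>L. c = (h (e, False), h (e, True), e) \<and> (\<exists>s. h (e, s) = v)"
      if c: "c \<in> snd (MG P)" "joins c x y" for c
    proof -
      obtain e where e: "e \<in> L" "c = (h (e, False), h (e, True), e)"
        using c(1) sub unfolding mg_edges_def by blast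
      then have "h (e, False) = v \<or> h (e, True) = v"
        using v c(2) by (auto simp: joins_def)
      with e show ?thesis by blast
    qed
    obtain e s where e: "e \<in> L" "a = (h (e, False), h (e, True), e)" "h (e, s) = v"
      using half[OF double(4,7)] by blast
    obtain e' s' where e': "e' \<in> L" "b = (h (e', False), h (e', True), e')" "h (e', s') = v"
      using half[OF double(5,8)] by blast
    \<comment> \<open>Under \<open>h\<close> an edge triple is determined by its label, so different
      edges have different labels.\<close>
    have "e \<noteq> e'" using double(6) e(2) e'(2) by metis
    then show ?thesis
      using e e' by (intro two[of e e' s s']) simp_all
  qed
qed

text \<open>A patchwork inside a larger multigraph occupies vertex and label sets that need not be
  initial segments, unlike those of \<open>patchworks n m\<close>.\<close>

definition patchworks_on :: "'v set \<Rightarrow> 'e set \<Rightarrow> ('v, 'e) mgraph set set" where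
  "patchworks_on V E = {P. patchwork P \<and> fst (MG P) = V \<and> edge_label ` snd (MG P) = E}"

text \<open>Containing P prescribes h on the half-edges with labels in E and nowhere else, so h is
  determined by its restriction to the other half-edges. The prescribed half-edges all end in V:
  they add nothing to the vertices outside V, while the vertices in V get their degree from
  P.\<close>

lemma card_extensions_of_patchwork:
  fixes V :: "'v set" and E :: "'e set"
  assumes P: "P \<in> patchworks_on V E" and V: "V \<subseteq> N" and E: "E \<subseteq> L" and fin: "finite N" "finite L"
  shows "card {h \<in> (L \<times> UNIV) \<rightarrow>\<^sub>E N.
      (\<forall>v\<in>N. 2 \<le> card {l \<in> L \<times> UNIV. h l = v}) \<and> P \<subseteq> patches (N, mg_edges L h)} =
    card {f \<in> ((L - E) \<times> (UNIV :: bool set)) \<rightarrow>\<^sub>E N.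
      \<forall>v\<in>N - V. 2 \<le> card {l \<in> (L - E) \<times> UNIV. f l = v}}"
    (is "card ?A = card ?B")
proof -
  have pw: "patchwork P" and fstP: "fst (MG P) = V" and labP: "edge_label ` snd (MG P) = E"
    using P by (auto simp: patchworks_on_def)
  have mg: "multigraph (MG P)" using pw by (simp add: patchwork_altdef)
  obtain k where k: "mg_edges E k = snd (MG P)"
    using multigraph_half_edges[OF mg] labP by auto
  have k_V: "k (e, s) \<in> V" if "e \<in> E" for e s
  proof -
    have "(k (e, False), k (e, True), e) \<in> snd (MG P)"
      unfolding k[symmetric] mem_mg_edges using that by simp
    then have "k (e, False) \<in> V" "k (e, True) \<in> V"
      using mg unfolding multigraph_def fstP by blast+
    then show ?thesis by (cases s) simp_all
  qed
  have sub_iff: "P \<subseteq> patches (N, mg_edges L h) \<longleftrightarrow> (\<forall>l\<in>E \<times> UNIV. k l = h l)"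
    if h: "h \<in> (L \<times> UNIV) \<rightarrow> N" for h
    using pw V E
    unfolding subset_patches_iff[OF multigraph_mg_edges[OF fin h]] fstP k[symmetric] fst_conv snd_conv
      mg_edges_subset_iff by blast
  have outside: "{l \<in> L \<times> UNIV. h l = v} = {l \<in> (L - E) \<times> UNIV. h l = v}"
    if kh: "\<forall>l\<in>E \<times> UNIV. k l = h l" and v: "v \<notin> V" for h v
  proof -
    have "h (e, s) \<noteq> v" if "e \<in> E" for e s
      using kh k_V[OF that, of s] v that by (metis SigmaI UNIV_I)
    then show ?thesis by blast
  qed
  let ?F = "\<lambda>h. restrict h ((L - E) \<times> UNIV)"
  let ?K = "\<lambda>f l. if l \<in> E \<times> UNIV then k l else f l"
  have "bij_betw ?F ?A ?B"
  proof (rule bij_betw_byWitness[where f' = ?K])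
    show "\<forall>h\<in>?A. ?K (?F h) = h"
    proof (intro ballI ext)
      fix h and l :: "'e \<times> bool"
      assume h: "h \<in> ?A"
      then have PiE: "h \<in> (L \<times> UNIV) \<rightarrow>\<^sub>E N" by blast
      then have kh: "\<forall>l\<in>E \<times> UNIV. k l = h l"
        using sub_iff[of h] h by blast
      consider "l \<in> E \<times> UNIV" | "l \<in> (L - E) \<times> UNIV" "l \<notin> E \<times> UNIV"
        | "l \<notin> L \<times> UNIV" "l \<notin> E \<times> UNIV" "l \<notin> (L - E) \<times> UNIV"
        using E by blast
      then show "?K (?F h) l = h l"
      proof cases
        case 1
        then have "k l = h l" using kh by blast
        then show ?thesis using 1 by simp
      next
        case 2
        then show ?thesis by simp
      next
        case 3
        then show ?thesis using PiE_arb[OF PiE 3(1)] by simp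
      qed
    qed
    show "\<forall>f\<in>?B. ?F (?K f) = f"
    proof (intro ballI ext)
      fix f and l :: "'e \<times> bool"
      assume "f \<in> ?B"
      then have PiE: "f \<in> ((L - E) \<times> UNIV) \<rightarrow>\<^sub>E N" by blast
      show "?F (?K f) l = f l"
      proof (cases "l \<in> (L - E) \<times> UNIV")
        case True
        then have "l \<notin> E \<times> UNIV" by blast
        then show ?thesis using True by simp
      next
        case False
        then show ?thesis using PiE_arb[OF PiE False] by simp
      qed
    qed
    show "?F ` ?A \<subseteq> ?B"
    proof (rule image_subsetI)
      fix h assume h: "h \<in> ?A"
      then have PiE: "h \<in> (L \<times> UNIV) \<rightarrow>\<^sub>E N" by blast
      then have kh: "\<forall>l\<in>E \<times> UNIV. k l = h l"
        using sub_iff[of h] h by blast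
      have "{l \<in> (L - E) \<times> UNIV. ?F h l = v} = {l \<in> L \<times> UNIV. h l = v}" if v: "v \<in> N - V" for v
      proof -
        have vV: "v \<notin> V" using v by blast
        have "{l \<in> (L - E) \<times> UNIV. ?F h l = v} = {l \<in> (L - E) \<times> UNIV. h l = v}"
          by (rule Collect_cong) auto
        then show ?thesis
          using outside[OF kh vV] by (rule trans[OF _ sym])
      qed
      moreover have "?F h \<in> ((L - E) \<times> UNIV) \<rightarrow>\<^sub>E N"
        using PiE by (intro restrict_PiE_iff[THEN iffD2]) blast
      ultimately show "?F h \<in> ?B"
        using h by (simp del: restrict_apply restrict_PiE_iff)
    qed
    show "?K ` ?B \<subseteq> ?A"
    proof (rule image_subsetI)
      fix f assume f: "f \<in> ?B"
      then have PiE_f: "f \<in> ((L - E) \<times> UNIV) \<rightarrow>\<^sub>E N" by blast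
      have PiE: "?K f \<in> (L \<times> UNIV) \<rightarrow>\<^sub>E N"
      proof (rule PiE_I)
        fix l :: "'e \<times> bool" assume "l \<in> L \<times> UNIV"
        then show "?K f l \<in> N"
          using k_V V PiE_mem[OF PiE_f, of l] by (cases l) auto
      next
        fix l :: "'e \<times> bool" assume "l \<notin> L \<times> UNIV"
        then have "l \<notin> E \<times> UNIV" "l \<notin> (L - E) \<times> UNIV" using E by blast+
        then show "?K f l = undefined" using PiE_arb[OF PiE_f, of l] by simp
      qed
      have kK: "\<forall>l\<in>E \<times> UNIV. k l = ?K f l" by simp
      then have sub: "P \<subseteq> patches (N, mg_edges L (?K f))"
        using sub_iff[of "?K f"] PiE by blast
      have "2 \<le> card {l \<in> L \<times> UNIV. ?K f l = v}" if "v \<in> N" for v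
      proof (cases "v \<in> V")
        case True
        have "multigraph (N, mg_edges L (?K f))"
          using PiE fin by (intro multigraph_mg_edges) blast+
        from sub[unfolded subset_patches_iff[OF this]]
        have "snd (MG P) \<subseteq> mg_edges L (?K f)" by simp
        then show ?thesis
          using pw True fin(2) unfolding fstP[symmetric] by (intro degree_patchwork_vertex)
      next
        case False
        have "{l \<in> L \<times> UNIV. ?K f l = v} = {l \<in> (L - E) \<times> UNIV. f l = v}"
          unfolding outside[OF kK False] by (rule Collect_cong) auto
        then show ?thesis using f that False by simp
      qed
      then show "?K f \<in> ?A"
        using PiE sub by blast
    qed
  qed
  then show ?thesis by (rule bij_betw_same_card)
qed

section \<open>Relabelling patchworks\<close>

definition relabel :: "('v \<Rightarrow> 'w) \<Rightarrow> ('e \<Rightarrow> 'd) \<Rightarrow> ('v, 'e) mgraph \<Rightarrow> ('w, 'd) mgraph" where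
  "relabel f g = map_prod (image f) (image (map_prod f (map_prod f g)))"

lemma relabel_inverse:
  assumes "\<And>x. f' (f x) = x" "\<And>x. g' (g x) = x"
  shows "relabel f' g' (relabel f g G) = G"
  using assms by (cases G) (simp add: relabel_def image_image map_prod.compositionality comp_def
      map_prod.identity[unfolded id_def])

lemma MG_relabel: "MG (relabel f g ` P) = relabel f g (MG P)"
  by (simp add: MG_def relabel_def image_Union image_image image_UN)

lemma edge_label_relabel: "edge_label ` snd (relabel f g G) = g ` edge_label ` snd G"
  by (simp add: relabel_def image_image edge_label_def split_def)

lemma patches_relabel:
  assumes "inj f" "inj g" "H \<in> patches G"
  shows "relabel f g H \<in> patches (relabel f g G)"
  using assms(3)
proof (cases rule: patches_cases)
  case (loop v e)
  have "is_loop (relabel f g G) (relabel f g H)"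
    unfolding is_loop_def using loop
    by (intro exI[of _ "f v"] exI[of _ "g e"]) (force simp: relabel_def)
  then show ?thesis by (simp add: patches_def)
next
  case (double v w a b)
  let ?m = "map_prod f (map_prod f g)"
  have "inj ?m" using assms by (intro prod.inj_map)
  then have "?m a \<noteq> ?m b" using double by (simp add: inj_eq)
  moreover have "f v \<noteq> f w" using double assms by (simp add: inj_eq)
  moreover have "joins (?m a) (f v) (f w)" "joins (?m b) (f v) (f w)"
    using double by (auto simp: joins_def)
  ultimately have "is_double_edge (relabel f g G) (relabel f g H)"
    unfolding is_double_edge_def using double
    by (intro exI[of _ "f v"] exI[of _ "f w"] exI[of _ "?m a"] exI[of _ "?m b"])
      (simp add: relabel_def)
  then show ?thesis by (simp add: patches_def)
qed

lemma multigraph_relabel: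
  assumes "inj g" "multigraph G"
  shows "multigraph (relabel f g G)"
proof -
  have "inj_on edge_label (snd (relabel f g G))"
  proof (rule inj_onI)
    fix x y assume "x \<in> snd (relabel f g G)" "y \<in> snd (relabel f g G)" "edge_label x = edge_label y"
    then obtain a b where "a \<in> snd G" "b \<in> snd G" "x = map_prod f (map_prod f g) a"
      "y = map_prod f (map_prod f g) b" "g (edge_label a) = g (edge_label b)"
      by (auto simp: relabel_def edge_label_def)
    moreover from this have "a = b"
      using assms by (auto simp: multigraph_def inj_on_def)
    ultimately show "x = y" by simp
  qed
  moreover have "\<forall>(v, w, e)\<in>snd (relabel f g G). v \<in> fst (relabel f g G) \<and> w \<in> fst (relabel f g G)"
    using assms by (fastforce simp: multigraph_def relabel_def)
  ultimately show ?thesis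
    using assms by (simp add: multigraph_def) (simp add: relabel_def)
qed

lemma patchworks_on_relabel:
  assumes "inj f" "inj g" "P \<in> patchworks_on V E"
  shows "relabel f g ` P \<in> patchworks_on (f ` V) (g ` E)"
proof -
  have P: "finite P" "multigraph (MG P)" "P \<subseteq> patches (MG P)"
    using assms(3) by (simp_all add: patchworks_on_def patchwork_altdef)
  have "relabel f g ` P \<subseteq> patches (relabel f g (MG P))"
    using P(3) patches_relabel[OF assms(1,2)] by blast
  then have "patchwork (relabel f g ` P)"
    using P multigraph_relabel[OF assms(2)] by (simp add: patchwork_altdef MG_relabel)
  moreover have "fst (MG (relabel f g ` P)) = f ` V"
    using assms by (simp add: MG_relabel patchworks_on_def) (simp add: relabel_def)
  moreover have "edge_label ` snd (MG (relabel f g ` P)) = g ` E"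
    using assms by (simp add: MG_relabel edge_label_relabel patchworks_on_def)
  ultimately show ?thesis by (simp add: patchworks_on_def)
qed

text \<open>The relabelling lemmas work with functions that are injective on the whole type. A
  bijection from A to B is therefore extended: B - A and A - B have equal size and are matched, and
  everything outside both sets stays fixed.\<close>

lemma ex_bij_image_eq:
  fixes A B :: "'a set"
  assumes "finite A" "finite B" "card A = card B"
  obtains f where "bij f" "f ` A = B"
proof -
  obtain f where f: "bij_betw f A B"
    using assms finite_same_card_bij by blast
  have "card (B - A) = card (A - B)"
    using assms by (simp add: card_Diff_subset_Int Int_commute)
  then obtain g where g: "bij_betw g (B - A) (A - B)"
    using assms finite_same_card_bij[of "B - A" "A - B"] by auto
  define h where "h x = (if x \<in> A then f x else if x \<in> B then g x else x)" for x
  have "bij_betw h A B" "bij_betw h (B - A) (A - B)" "bij_betw h (- (A \<union> B)) (- (A \<union> B))"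
  proof -
    show "bij_betw h A B"
      using f by (rule bij_betw_cong[THEN iffD1, rotated]) (simp add: h_def)
    show "bij_betw h (B - A) (A - B)"
      using g by (rule bij_betw_cong[THEN iffD1, rotated]) (simp add: h_def)
    show "bij_betw h (- (A \<union> B)) (- (A \<union> B))"
      using bij_betw_id by (rule bij_betw_cong[THEN iffD1, rotated]) (simp add: h_def)
  qed
  then have "bij_betw h (A \<union> (B - A) \<union> - (A \<union> B)) (B \<union> (A - B) \<union> - (A \<union> B))"
    by (intro bij_betw_combine) auto
  moreover have "A \<union> (B - A) \<union> - (A \<union> B) = UNIV" "B \<union> (A - B) \<union> - (A \<union> B) = UNIV" by auto
  ultimately have "bij h" by simp
  with \<open>bij_betw h A B\<close> that show ?thesis by (simp add: bij_betw_def)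
qed

text \<open>Relabelling by bijections is injective on multigraphs and so keeps the number of
  patches. Sums over V and E thereby become sums over their cardinalities.\<close>

lemma sum_patchworks_on:
  fixes V E :: "nat set"
  assumes "finite V" "finite E"
  shows "(\<Sum>P\<in>patchworks_on V E. F (card P)) = (\<Sum>P\<in>patchworks (card V) (card E). F (card P))"
proof -
  obtain f where f: "bij f" "f ` {1..card V} = V"
    using ex_bij_image_eq[of "{1..card V}" V] assms by auto
  obtain g where g: "bij g" "g ` {1..card E} = E"
    using ex_bij_image_eq[of "{1..card E}" E] assms by auto
  have inv: "inv f ` V = {1..card V}" "inv g ` E = {1..card E}"
    using f g by (metis bij_is_inj image_inv_f_f)+
  have inj: "inj f" "inj g" "inj (inv f)" "inj (inv g)"
    using f g by (auto simp: bij_is_inj bij_imp_bij_inv)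
  have inverse: "relabel f g ` relabel (inv f) (inv g) ` P = P"
      "relabel (inv f) (inv g) ` relabel f g ` P = P" for P
    using f g by (auto simp: image_image relabel_inverse bij_is_inj bij_is_surj surj_f_inv_f)
  have "patchworks (card V) (card E) = patchworks_on {1..card V} {1..card E}"
    by (simp add: patchworks_def patchworks_on_def)
  moreover have "(\<Sum>P\<in>patchworks_on V E. F (card P)) = (\<Sum>P\<in>patchworks_on {1..card V} {1..card E}. F (card P))"
  proof (rule sum.reindex_bij_witness[where i = "image (relabel f g)" and j = "image (relabel (inv f) (inv g))"])
    fix P assume P: "P \<in> patchworks_on V E"
    show "relabel (inv f) (inv g) ` P \<in> patchworks_on {1..card V} {1..card E}"
      using patchworks_on_relabel[OF inj(3,4) P] by (simp only: inv)
    have "inj (relabel (inv f) (inv g))"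
      using f g by (intro inj_on_inverseI[where g = "relabel f g"] relabel_inverse)
        (auto simp: bij_is_surj surj_f_inv_f)
    then show "F (card (relabel (inv f) (inv g) ` P)) = F (card P)"
      by (simp add: card_image inj_on_subset)
  next
    fix P assume P: "P \<in> patchworks_on {1..card V} {1..card E}"
    show "relabel f g ` P \<in> patchworks_on V E"
      using patchworks_on_relabel[OF inj(1,2) P] by (simp only: f g)
  qed (rule inverse)+
  ultimately show ?thesis by simp
qed

section \<open>Multigraphs without patches\<close>

definition ends :: "('e \<times> bool \<Rightarrow> 'v) \<Rightarrow> 'e \<Rightarrow> 'v set" where
  "ends h e = {h (e, False), h (e, True)}"

lemma card_ends: "card (ends h e) = 2 \<longleftrightarrow> h (e, False) \<noteq> h (e, True)"
  by (auto simp: ends_def card_insert_if)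

lemma mem_ends: "v \<in> ends h e \<longleftrightarrow> (\<exists>s. h (e, s) = v)"
  by (auto simp: ends_def ex_bool_eq)

lemma bij_betw_insert_iff:
  assumes "a \<notin> A"
  shows "bij_betw g (insert a A) B \<longleftrightarrow> g a \<in> B \<and> bij_betw g A (B - {g a})"
  using assms by (simp add: bij_betw_def) blast

text \<open>An ordered pair picks an edge together with an orientation; each two-element set arises
  from exactly two pairs.\<close>

lemma card_pairs_of_doubletons:
  assumes "finite Es" "\<And>e. e \<in> Es \<Longrightarrow> card e = 2"
  shows "card {(x, y). {x, y} \<in> Es} = 2 * card Es"
    and "finite {(x, y). {x, y} \<in> Es}"
proof -
  have pairs: "card {(x, y). {x, y} = e} = 2 \<and> finite {(x, y). {x, y} = e}" if e: "e \<in> Es" for e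
  proof -
    obtain u v where uv: "e = {u, v}" "u \<noteq> v"
      using assms(2)[OF e] unfolding card_2_iff by blast
    then have "{(x, y). {x, y} = e} = {(u, v), (v, u)}"
      by (auto simp: doubleton_eq_iff)
    then show ?thesis using uv by simp
  qed
  have eq: "{(x, y). {x, y} \<in> Es} = (\<Union>e\<in>Es. {(x, y). {x, y} = e})" by auto
  show "finite {(x, y). {x, y} \<in> Es}"
    unfolding eq using pairs assms by blast
  have "card {(x, y). {x, y} \<in> Es} = (\<Sum>e\<in>Es. card {(x, y). {x, y} = e})"
    unfolding eq using pairs assms by (intro card_UN_disjoint) auto
  also have "\<dots> = (\<Sum>e\<in>Es. 2)"
    using pairs by (intro sum.cong) auto
  finally show "card {(x, y). {x, y} \<in> Es} = 2 * card Es" by simp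
qed

text \<open>In the induction the new label picks an edge and its orientation, one of 2 n ordered
  pairs for n edges, and the other labels are left with the remaining edges: 2 n times 2^(n-1)
  (n-1)!. Edges are told apart by their end sets, so nothing is counted twice.\<close>

lemma card_labelled_orientations:
  fixes L :: "'e set" and Es :: "'v set set"
  assumes "finite L" "finite Es" "card L = card Es" "\<And>e. e \<in> Es \<Longrightarrow> card e = 2 \<and> e \<subseteq> N"
  shows "card {h \<in> (L \<times> UNIV) \<rightarrow>\<^sub>E N. bij_betw (ends h) L Es} = 2 ^ card L * fact (card L)"
  using assms
proof (induction L arbitrary: Es)
  case empty
  \<comment> \<open>With no labels the only extensional map is constantly \<open>undefined\<close>,
    and it counts once.\<close>
  then show ?case
    using card_1_singleton_iff[of "{h. h = (\<lambda>x. undefined) \<and> bij_betw (ends h) {} {}}"]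
    by (auto simp: bij_betw_def)
next
  case (insert a L Es)
  define W where "W L Es = {h \<in> (L \<times> UNIV) \<rightarrow>\<^sub>E N. bij_betw (ends h) L Es}"
    for L :: "'e set" and Es
  define Q where "Q = {(x, y). {x, y} \<in> Es}"
  have cardQ: "card Q = 2 * card Es" and finQ: "finite Q"
    unfolding Q_def by (rule card_pairs_of_doubletons; use insert.prems in simp)+
  have IH: "card (W L (Es - {{x, y}})) = 2 ^ card L * fact (card L)" if "(x, y) \<in> Q" for x y
    unfolding W_def using insert.prems insert.hyps that
    by (intro insert.IH) (auto simp: Q_def)
  have ends_cong: "bij_betw (ends h) L B = bij_betw (ends h') L B"
    if "\<And>e s. e \<in> L \<Longrightarrow> h (e, s) = h' (e, s)" for h h' B
    using that by (intro bij_betw_cong) (simp add: ends_def)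
  let ?F = "\<lambda>h. ((h (a, False), h (a, True)), restrict h (L \<times> UNIV))"
  let ?K = "\<lambda>((x, y), h). h((a, False) := x, (a, True) := y)"
  have "bij_betw ?F (W (insert a L) Es) (SIGMA (x, y):Q. W L (Es - {{x, y}}))"
  proof (rule bij_betw_byWitness[where f' = ?K])
    show "\<forall>h\<in>W (insert a L) Es. ?K (?F h) = h"
    proof (intro ballI ext)
      fix h l assume "h \<in> W (insert a L) Es"
      then have PiE: "h \<in> (insert a L \<times> UNIV) \<rightarrow>\<^sub>E N" by (simp add: W_def)
      show "?K (?F h) l = h l"
      proof (cases "l \<in> insert a L \<times> UNIV")
        case True
        then show ?thesis by (cases l; cases "snd l") auto
      next
        case False
        then show ?thesis using PiE_arb[OF PiE False] by (cases l) auto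
      qed
    qed
    show "\<forall>p\<in>SIGMA (x, y):Q. W L (Es - {{x, y}}). ?F (?K p) = p"
    proof
      fix p assume "p \<in> (SIGMA (x, y):Q. W L (Es - {{x, y}}))"
      then obtain x y h where p: "p = ((x, y), h)" and "h \<in> W L (Es - {{x, y}})"
        by auto
      then have PiE: "h \<in> (L \<times> UNIV) \<rightarrow>\<^sub>E N" by (simp add: W_def)
      have "restrict (h((a, False) := x, (a, True) := y)) (L \<times> UNIV) = h"
      proof
        fix l show "restrict (h((a, False) := x, (a, True) := y)) (L \<times> UNIV) l = h l"
          using insert.hyps(2) PiE_arb[OF PiE, of l] by (cases "l \<in> L \<times> UNIV") auto
      qed
      then show "?F (?K p) = p" by (simp add: p)
    qed
    show "?F ` W (insert a L) Es \<subseteq> (SIGMA (x, y):Q. W L (Es - {{x, y}}))"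
    proof (rule image_subsetI)
      fix h assume h: "h \<in> W (insert a L) Es"
      then have 1: "ends h a \<in> Es" and 2: "bij_betw (ends h) L (Es - {ends h a})"
        and PiE: "h \<in> (insert a L \<times> UNIV) \<rightarrow>\<^sub>E N"
        using insert.hyps(2) by (simp_all add: W_def bij_betw_insert_iff)
      have "bij_betw (ends (restrict h (L \<times> UNIV))) L (Es - {ends h a})"
        using 2 by (rule ends_cong[THEN iffD1, rotated]) simp
      moreover have "restrict h (L \<times> UNIV) \<in> (L \<times> UNIV) \<rightarrow>\<^sub>E N"
        using PiE by (intro restrict_PiE_iff[THEN iffD2]) blast
      ultimately have "restrict h (L \<times> UNIV) \<in> W L (Es - {{h (a, False), h (a, True)}})"
        unfolding W_def ends_def[of h a] by blast
      moreover have "(h (a, False), h (a, True)) \<in> Q"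
        using 1 by (simp add: Q_def ends_def)
      ultimately show "?F h \<in> (SIGMA (x, y):Q. W L (Es - {{x, y}}))"
        by simp
    qed
    show "?K ` (SIGMA (x, y):Q. W L (Es - {{x, y}})) \<subseteq> W (insert a L) Es"
    proof (rule image_subsetI)
      fix p assume "p \<in> (SIGMA (x, y):Q. W L (Es - {{x, y}}))"
      then obtain x y h where p: "p = ((x, y), h)" and xy: "{x, y} \<in> Es"
        and h: "h \<in> W L (Es - {{x, y}})"
        by (auto simp: Q_def)
      define h' where "h' = h((a, False) := x, (a, True) := y)"
      have PiE: "h \<in> (L \<times> UNIV) \<rightarrow>\<^sub>E N" and bij: "bij_betw (ends h) L (Es - {{x, y}})"
        using h by (simp_all add: W_def)
      have "bij_betw (ends h') L (Es - {{x, y}})"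
        using bij by (rule ends_cong[THEN iffD1, rotated]) (use insert.hyps(2) in \<open>auto simp: h'_def\<close>)
      moreover have "ends h' a = {x, y}" by (simp add: ends_def h'_def)
      ultimately have "bij_betw (ends h') (insert a L) Es"
        using xy insert.hyps(2) by (simp add: bij_betw_insert_iff)
      moreover have "h' \<in> (insert a L \<times> UNIV) \<rightarrow>\<^sub>E N"
      proof (rule PiE_I)
        have xyN: "x \<in> N" "y \<in> N" using xy insert.prems(3) by blast+
        fix l assume "l \<in> insert a L \<times> (UNIV :: bool set)"
        then show "h' l \<in> N"
          using xyN PiE_mem[OF PiE, of l] by (cases l; cases "snd l") (auto simp: h'_def)
      next
        fix l assume "l \<notin> insert a L \<times> (UNIV :: bool set)"
        then show "h' l = undefined"
          using PiE_arb[OF PiE, of l] by (cases l) (auto simp: h'_def)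
      qed
      ultimately have "h' \<in> W (insert a L) Es" by (simp add: W_def)
      then show "?K p \<in> W (insert a L) Es" by (simp add: p h'_def)
    qed
  qed
  then have "card (W (insert a L) Es) = card (SIGMA (x, y):Q. W L (Es - {{x, y}}))"
    by (rule bij_betw_same_card)
  also have "\<dots> = (\<Sum>(x, y)\<in>Q. card (W L (Es - {{x, y}})))"
  proof -
    \<comment> \<open>Read off from \<open>IH\<close>: the cardinality is positive, whereas
      \<open>card\<close> is 0 on infinite sets.\<close>
    have "finite (W L (Es - {{x, y}}))" if "(x, y) \<in> Q" for x y
      using IH[OF that] by (intro card_ge_0_finite) simp
    then show ?thesis using finQ by (subst card_SigmaI) (auto simp: split_def)
  qed
  also have "\<dots> = (\<Sum>p\<in>Q. 2 ^ card L * fact (card L))"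
    using IH by (intro sum.cong) auto
  also have "\<dots> = 2 ^ card (insert a L) * fact (card (insert a L))"
    using insert.hyps insert.prems(2) by (simp add: cardQ algebra_simps flip: insert.prems(2))
  finally show ?case by (simp add: W_def)
qed

text \<open>The two conditions exclude the two kinds of patch: an edge whose end set is a singleton
  is a loop, and two labels with the same two-element end set form a double edge. Orientation is
  invisible to \<open>ends\<close>, as it is to \<open>joins\<close>.\<close>

lemma no_patches_iff:
  assumes h: "h \<in> L \<times> UNIV \<rightarrow> N"
  shows "patches (N, mg_edges L h) = {} \<longleftrightarrow> (\<forall>e\<in>L. card (ends h e) = 2) \<and> inj_on (ends h) L"
proof (intro iffI conjI ballI)
  assume no: "patches (N, mg_edges L h) = {}"
  have mem: "(h (e, False), h (e, True), e) \<in> mg_edges L h" "h (e, s) \<in> N" if "e \<in> L" for e s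
    using that h by (auto simp: mem_mg_edges)
  show noloop: "card (ends h e) = 2" if "e \<in> L" for e
  proof (rule ccontr)
    assume "card (ends h e) \<noteq> 2"
    then have "h (e, True) = h (e, False)" by (simp add: card_ends)
    then have "is_loop (N, mg_edges L h) ({h (e, False)}, {(h (e, False), h (e, False), e)})"
      using mem[OF that] unfolding is_loop_def by fastforce
    then show False using no by (auto simp: patches_def)
  qed
  show "inj_on (ends h) L"
  proof (rule inj_onI, rule ccontr)
    fix e e' assume e: "e \<in> L" "e' \<in> L" "ends h e = ends h e'" "e \<noteq> e'"
    let ?a = "(h (e, False), h (e, True), e)" and ?b = "(h (e', False), h (e', True), e')"
    have "joins ?a (h (e, False)) (h (e, True))" "joins ?b (h (e, False)) (h (e, True))"
      using e(3) by (auto simp: joins_def ends_def doubleton_eq_iff)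
    moreover have "h (e, False) \<noteq> h (e, True)"
      using noloop[OF e(1)] by (simp add: card_ends)
    moreover have "?a \<noteq> ?b" using e(4) by simp
    ultimately have "is_double_edge (N, mg_edges L h) ({h (e, False), h (e, True)}, {?a, ?b})"
      using mem[OF e(1)] mem[OF e(2)] unfolding is_double_edge_def fst_conv snd_conv by blast
    then show False using no by (auto simp: patches_def)
  qed
next
  assume simple: "(\<forall>e\<in>L. card (ends h e) = 2) \<and> inj_on (ends h) L"
  show "patches (N, mg_edges L h) = {}"
  proof (rule equals0I)
    fix H assume "H \<in> patches (N, mg_edges L h)"
    then show False
    proof (cases rule: patches_cases)
      case (loop v e)
      then show False using simple by (auto simp: mem_mg_edges card_ends)
    next
      case (double v w a b)
      have lab: "\<exists>e\<in>L. c = (h (e, False), h (e, True), e) \<and> ends h e = {v, w}"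
        if "c \<in> mg_edges L h" "joins c v w" for c
        using that by (auto simp: joins_def mem_mg_edges ends_def)
      obtain e where e: "e \<in> L" "a = (h (e, False), h (e, True), e)" "ends h e = {v, w}"
        using lab[of a] double by auto
      obtain e' where e': "e' \<in> L" "b = (h (e', False), h (e', True), e')" "ends h e' = {v, w}"
        using lab[of b] double by auto
      have "ends h e = ends h e'" by (simp only: e(3) e'(3))
      with simple e(1) e'(1) have "e = e'" by (meson inj_onD)
      then show False using e e' \<open>a \<noteq> b\<close> by simp
    qed
  qed
qed

text \<open>Every edge has two different ends, so exactly one half of an edge containing v lies at
  v. Sending that half to its edge is a bijection.\<close>

lemma degree_eq_half_edges:
  assumes bij: "bij_betw (ends h) L Es" and two: "\<And>e. e \<in> Es \<Longrightarrow> card e = 2"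
  shows "card {e \<in> Es. v \<in> e} = card {l \<in> L \<times> UNIV. h l = v}"
proof -
  have "bij_betw (\<lambda>l. ends h (fst l)) {l \<in> L \<times> UNIV. h l = v} {e \<in> Es. v \<in> e}"
  proof (rule bij_betwI')
    fix l l' assume l: "l \<in> {l \<in> L \<times> UNIV. h l = v}" "l' \<in> {l \<in> L \<times> UNIV. h l = v}"
    show "ends h (fst l) = ends h (fst l') \<longleftrightarrow> l = l'"
    proof
      assume eq: "ends h (fst l) = ends h (fst l')"
      then have fst: "fst l = fst l'"
        using l bij by (auto simp: bij_betw_def dest: inj_onD)
      have "card (ends h (fst l)) = 2"
        using l bij two by (auto simp: bij_betw_def)
      then have "h (fst l, False) \<noteq> h (fst l, True)" by (simp add: card_ends)
      then have "snd l = snd l'"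
        using l fst by (cases l; cases l'; cases "snd l"; cases "snd l'") auto
      with fst show "l = l'" by (simp add: prod_eq_iff)
    qed simp
  next
    fix l assume "l \<in> {l \<in> L \<times> UNIV. h l = v}"
    then show "ends h (fst l) \<in> {e \<in> Es. v \<in> e}"
      using bij by (cases l) (auto simp: bij_betw_def mem_ends)
  next
    fix E assume E: "E \<in> {e \<in> Es. v \<in> e}"
    then obtain e where "e \<in> L" "E = ends h e"
      using bij by (auto simp: bij_betw_def)
    moreover obtain s where "h (e, s) = v"
      using E \<open>E = ends h e\<close> by (auto simp: mem_ends)
    ultimately show "\<exists>l\<in>{l \<in> L \<times> UNIV. h l = v}. E = ends h (fst l)"
      by (intro bexI[of _ "(e, s)"]) auto
  qed
  then show ?thesis by (simp add: bij_betw_same_card)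
qed

text \<open>Forgetting labels and orientations maps a patch-free multigraph to the simple graph
  formed by its end sets. The fibre over a core G is \<open>W G\<close>, whose size is the same for
  all G.\<close>

lemma card_simple_multigraphs:
  assumes fin: "finite N" "finite L"
  shows "card {h \<in> (L \<times> UNIV) \<rightarrow>\<^sub>E N.
      (\<forall>v\<in>N. 2 \<le> card {l \<in> L \<times> UNIV. h l = v}) \<and> patches (N, mg_edges L h) = {}} =
    2 ^ card L * fact (card L) * card {G. core G \<and> fst G = N \<and> card (snd G) = card L}"
    (is "card ?A = _ * card ?C")
proof -
  define W where "W G = {h \<in> (L \<times> UNIV) \<rightarrow>\<^sub>E N. bij_betw (ends h) L (snd G)}" for G :: "'a sgraph"
  have C: "finite (snd G)" "card (snd G) = card L" "\<And>e. e \<in> snd G \<Longrightarrow> card e = 2 \<and> e \<subseteq> N"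
    "snd G \<subseteq> Pow N" if "G \<in> ?C" for G
  proof -
    have G: "core G" "fst G = N" "card (snd G) = card L" using that by simp_all
    then show "card (snd G) = card L" by simp
    show edges: "card e = 2 \<and> e \<subseteq> N" if "e \<in> snd G" for e
      using G(1,2) that by (simp add: core_def simple_graph_def)
    then show "snd G \<subseteq> Pow N" by blast
    then show "finite (snd G)" by (rule finite_subset) (simp add: fin)
  qed
  have W_A: "W G \<subseteq> ?A" if G: "G \<in> ?C" for G
  proof
    fix h assume "h \<in> W G"
    then have PiE: "h \<in> (L \<times> UNIV) \<rightarrow>\<^sub>E N" and bij: "bij_betw (ends h) L (snd G)"
      by (simp_all add: W_def)
    have "h \<in> L \<times> UNIV \<rightarrow> N" using PiE by blast
    moreover have "\<forall>e\<in>L. card (ends h e) = 2"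
      using C(3)[OF G] bij_betwE[OF bij] by blast
    ultimately have "patches (N, mg_edges L h) = {}"
      using bij by (simp add: no_patches_iff bij_betw_def)
    moreover have "2 \<le> card {l \<in> L \<times> UNIV. h l = v}" if "v \<in> N" for v
    proof -
      have "core G" "fst G = N" using G by simp_all
      then have "2 \<le> degree_of G v" using that by (simp add: core_def)
      then show ?thesis
        using degree_eq_half_edges[OF bij, of v] C(3)[OF G] by (simp add: degree_of_def)
    qed
    ultimately show "h \<in> ?A" using PiE by blast
  qed
  have A_W: "(N, ends h ` L) \<in> ?C \<and> h \<in> W (N, ends h ` L)" if h: "h \<in> ?A" for h
  proof -
    define Es where "Es = ends h ` L"
    have PiE: "h \<in> (L \<times> UNIV) \<rightarrow>\<^sub>E N" and "patches (N, mg_edges L h) = {}"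
      and deg: "\<And>v. v \<in> N \<Longrightarrow> 2 \<le> card {l \<in> L \<times> UNIV. h l = v}"
      using h by simp_all
    moreover have "h \<in> L \<times> UNIV \<rightarrow> N" using PiE by blast
    ultimately have two: "\<forall>e\<in>L. card (ends h e) = 2" and inj: "inj_on (ends h) L"
      by (simp_all add: no_patches_iff)
    have two': "card e = 2" if "e \<in> Es" for e
      using two that unfolding Es_def by blast
    have bij: "bij_betw (ends h) L Es" using inj by (simp add: bij_betw_def Es_def)
    have "ends h e \<subseteq> N" if "e \<in> L" for e
      using PiE_mem[OF PiE] that by (simp add: ends_def)
    then have "simple_graph (N, Es)"
      using two fin by (simp add: simple_graph_def Es_def)
    moreover have "2 \<le> degree_of (N, Es) v" if "v \<in> N" for v
      using degree_eq_half_edges[OF bij, of v] two' deg[OF that] by (simp add: degree_of_def)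
    moreover have "card Es = card L" using bij by (simp add: bij_betw_same_card)
    ultimately have "(N, Es) \<in> ?C" by (simp add: core_def)
    moreover have "h \<in> W (N, Es)" using PiE bij by (simp add: W_def)
    ultimately show ?thesis by (simp add: Es_def)
  qed
  have "?A = (\<Union>G\<in>?C. W G)"
  proof
    show "?A \<subseteq> (\<Union>G\<in>?C. W G)"
    proof
      fix h assume "h \<in> ?A"
      from A_W[OF this] show "h \<in> (\<Union>G\<in>?C. W G)"
        by (elim conjE) (rule UN_I)
    qed
    show "(\<Union>G\<in>?C. W G) \<subseteq> ?A"
      using W_A by (rule UN_least)
  qed
  also have "card \<dots> = (\<Sum>G\<in>?C. card (W G))"
  proof (intro card_UN_disjoint ballI impI)
    show "finite ?C"
    proof (rule finite_subset)
      show "?C \<subseteq> {N} \<times> Pow (Pow N)"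
      proof
        fix G assume "G \<in> ?C"
        then show "G \<in> {N} \<times> Pow (Pow N)"
          using C(4)[of G] by (simp add: mem_Times_iff)
      qed
    qed (use fin in simp)
    show "finite (W G)" for G
      using fin by (simp add: W_def finite_PiE)
    fix G G' assume GG': "G \<in> ?C" "G' \<in> ?C" "G \<noteq> G'"
    then have "snd G \<noteq> snd G'" by (simp add: prod_eq_iff)
    moreover have W: "ends h ` L = snd G''" if "h \<in> W G''" for h G''
      using that by (simp add: W_def bij_betw_imp_surj_on)
    ultimately show "W G \<inter> W G' = {}"
      by (metis W disjoint_iff)
  qed
  also have "\<dots> = (\<Sum>G\<in>?C. 2 ^ card L * fact (card L))"
  proof (intro sum.cong refl)
    fix G assume "G \<in> ?C"
    note C = C[OF this]
    show "card (W G) = 2 ^ card L * fact (card L)"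
      unfolding W_def using fin(2) C(1) C(2)[symmetric] C(3) by (rule card_labelled_orientations)
  qed
  finally show ?thesis by simp
qed

section \<open>Inclusion-exclusion\<close>

lemma finite_patchworks_within:
  assumes "finite N" "finite L"
  shows "finite {P. patchwork P \<and> fst (MG P) \<subseteq> N \<and> edge_label ` snd (MG P) \<subseteq> L}"
proof (rule finite_subset)
  show "{P. patchwork P \<and> fst (MG P) \<subseteq> N \<and> edge_label ` snd (MG P) \<subseteq> L}
      \<subseteq> Pow (Pow N \<times> Pow (N \<times> N \<times> L))"
  proof (intro subsetI PowI)
    fix P H assume P: "P \<in> {P. patchwork P \<and> fst (MG P) \<subseteq> N \<and> edge_label ` snd (MG P) \<subseteq> L}"
      and H: "H \<in> P"
    have "multigraph (MG P)" using P by (simp add: patchwork_def)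
    have "snd (MG P) \<subseteq> N \<times> N \<times> L"
    proof
      fix a assume a: "a \<in> snd (MG P)"
      then have "edge_label a \<in> L" using P by blast
      moreover have "fst a \<in> fst (MG P)" "fst (snd a) \<in> fst (MG P)"
        using a \<open>multigraph (MG P)\<close> by (auto simp: multigraph_def)
      ultimately show "a \<in> N \<times> N \<times> L"
        using P by (cases a) (auto simp: edge_label_def)
    qed
    moreover have "fst (MG P) \<subseteq> N" using P by blast
    ultimately show "H \<in> Pow N \<times> Pow (N \<times> N \<times> L)"
      using subset_MG[OF H] unfolding mem_Times_iff by blast
  qed
  show "finite (Pow (Pow N \<times> Pow (N \<times> N \<times> L)))"
    using assms by simp
qed

text \<open>
  Inclusion-exclusion over the patches of a multigraph with minimum degree at least 2: the
  patchworks contained in it sum up to 1 if it is simple and to 0 otherwise.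
\<close>

lemma card_cores_inclusion_exclusion:
  fixes N :: "'v set" and L :: "'e set"
  assumes fin: "finite N" "finite L"
  shows "of_nat (2 ^ card L * fact (card L) * card {G. core G \<and> fst G = N \<and> card (snd G) = card L}) =
    (\<Sum>V\<in>Pow N. \<Sum>E\<in>Pow L. (\<Sum>P\<in>patchworks_on V E. (-1) ^ card P) *
      of_nat (card {f \<in> ((L - E) \<times> (UNIV :: bool set)) \<rightarrow>\<^sub>E N.
        \<forall>v\<in>N - V. 2 \<le> card {l \<in> (L - E) \<times> UNIV. f l = v}}) :: 'a::comm_ring_1)"
proof -
  define A where "A = {h \<in> (L \<times> (UNIV :: bool set)) \<rightarrow>\<^sub>E N. \<forall>v\<in>N. 2 \<le> card {l \<in> L \<times> UNIV. h l = v}}"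
  define \<P> where "\<P> = {P :: ('v, 'e) mgraph set.
    patchwork P \<and> fst (MG P) \<subseteq> N \<and> edge_label ` snd (MG P) \<subseteq> L}"
  define B where "B V E = {f \<in> ((L - E) \<times> (UNIV :: bool set)) \<rightarrow>\<^sub>E N.
    \<forall>v\<in>N - V. 2 \<le> card {l \<in> (L - E) \<times> UNIV. f l = v}}" for V E
  have finA: "finite A"
    using fin by (simp add: A_def finite_PiE)
  have fin\<P>: "finite \<P>"
    unfolding \<P>_def using fin by (rule finite_patchworks_within)
  have mg: "multigraph (N, mg_edges L h)" if "h \<in> A" for h
    using that fin by (intro multigraph_mg_edges) (auto simp: A_def)
  \<comment> \<open>The subsets over which the signs cancel are drawn from one finite set
    \<open>\<P>\<close> that does not depend on h; this permits the exchange of sums.\<close>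
  have Pow_patches: "Pow (patches (N, mg_edges L h)) = {P \<in> \<P>. P \<subseteq> patches (N, mg_edges L h)}"
    if "h \<in> A" for h
  proof -
    have "edge_label ` mg_edges L h = L"
      by (simp add: mg_edges_def edge_label_def image_image)
    then have "P \<in> \<P>" if "P \<subseteq> patches (N, mg_edges L h)" for P
      using that image_mono[of "snd (MG P)" "mg_edges L h" edge_label]
        subset_patches_iff[OF mg[OF \<open>h \<in> A\<close>], of P] by (simp add: \<P>_def)
    then show ?thesis by blast
  qed
  have "of_nat (2 ^ card L * fact (card L) * card {G. core G \<and> fst G = N \<and> card (snd G) = card L}) =
      (of_nat (card {h \<in> A. patches (N, mg_edges L h) = {}}) :: 'a)"
    using card_simple_multigraphs[OF fin] by (simp add: A_def conj_assoc)
  also have "\<dots> = (\<Sum>h\<in>A. if patches (N, mg_edges L h) = {} then 1 else 0)"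
    using finA by (simp add: sum.If_cases Int_def)
  also have "\<dots> = (\<Sum>h\<in>A. \<Sum>P\<in>{P \<in> \<P>. P \<subseteq> patches (N, mg_edges L h)}. (-1) ^ card P)"
  proof (intro sum.cong refl)
    fix h assume h: "h \<in> A"
    show "(if patches (N, mg_edges L h) = {} then 1 else 0) =
        (\<Sum>P\<in>{P \<in> \<P>. P \<subseteq> patches (N, mg_edges L h)}. (-1) ^ card P :: 'a)"
      unfolding Pow_patches[OF h, symmetric]
      by (rule sum_minus_one_power_card_Pow[OF finite_patches[OF mg[OF h]], symmetric])
  qed
  also have "\<dots> = (\<Sum>P\<in>\<P>. \<Sum>h\<in>{h \<in> A. P \<subseteq> patches (N, mg_edges L h)}. (-1) ^ card P)"
    using finA fin\<P> by (rule sum.swap_restrict)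
  also have "\<dots> = (\<Sum>P\<in>\<P>. (-1) ^ card P * of_nat (card {h \<in> A. P \<subseteq> patches (N, mg_edges L h)}))"
    by (simp add: mult.commute)
  \<comment> \<open>Grouping by occupied vertices and labels: within a group the number of
    completions is constant and factors out, leaving a sum of signs.\<close>
  also have "\<dots> = (\<Sum>q\<in>Pow N \<times> Pow L.
      \<Sum>P\<in>{P \<in> \<P>. (fst (MG P), edge_label ` snd (MG P)) = q}.
        (-1) ^ card P * of_nat (card {h \<in> A. P \<subseteq> patches (N, mg_edges L h)}))"
    using fin fin\<P> by (intro sum.group[symmetric]) (auto simp: \<P>_def)
  also have "\<dots> = (\<Sum>(V, E)\<in>Pow N \<times> Pow L.
      (\<Sum>P\<in>patchworks_on V E. (-1) ^ card P) * of_nat (card (B V E)))"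
  proof (intro sum.cong refl, clarify)
    fix V E assume VE: "V \<subseteq> N" "E \<subseteq> L"
    have "{P \<in> \<P>. (fst (MG P), edge_label ` snd (MG P)) = (V, E)} = patchworks_on V E"
      using VE unfolding \<P>_def patchworks_on_def by blast
    moreover have "card {h \<in> A. P \<subseteq> patches (N, mg_edges L h)} = card (B V E)"
      if "P \<in> patchworks_on V E" for P
      using card_extensions_of_patchwork[OF that VE fin] by (simp add: A_def B_def conj_assoc)
    ultimately show "(\<Sum>P\<in>{P \<in> \<P>. (fst (MG P), edge_label ` snd (MG P)) = (V, E)}.
          (-1) ^ card P * of_nat (card {h \<in> A. P \<subseteq> patches (N, mg_edges L h)})) =
        (\<Sum>P\<in>patchworks_on V E. (-1) ^ card P) * (of_nat (card (B V E)) :: 'a)"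
      by (simp add: sum_distrib_right)
  qed
  also have "\<dots> = (\<Sum>V\<in>Pow N. \<Sum>E\<in>Pow L.
      (\<Sum>P\<in>patchworks_on V E. (-1) ^ card P) * of_nat (card (B V E)))"
    by (simp add: sum.cartesian_product)
  finally show ?thesis by (simp only: B_def)
qed

text \<open>Up to the factor 1 / (2^m m! n!), this is the coefficient of w^m z^n in P(z, w,
  -1).\<close>

definition signed_patchworks :: "nat \<Rightarrow> nat \<Rightarrow> rat" where
  "signed_patchworks n m = (\<Sum>P\<in>patchworks n m. (-1) ^ card P)"

text \<open>Only the sizes k of V and j of E matter, so their choices become binomial coefficients.
  The M - j edges outside the patchwork leave 2 (M - j) half-edges to distribute.\<close>

lemma card_cores_eq:
  "of_nat (2 ^ M * fact M * card (cores n M)) =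
    (\<Sum>k\<le>n. of_nat (n choose k) * (\<Sum>j\<le>M. of_nat (M choose j) *
      (signed_patchworks k j * (fact (2 * (M - j)) *
        (fps_exp 1 ^ k * (fps_exp 1 - 1 - fps_X) ^ (n - k)) $ (2 * (M - j))))))"
proof -
  let ?N = "{1..n}" and ?L = "{1..M}"
  let ?c = "\<lambda>k j. fact (2 * (M - j)) *
    (fps_exp 1 ^ k * (fps_exp 1 - 1 - fps_X) ^ (n - k)) $ (2 * (M - j)) :: rat"
  have "cores n M = {G. core G \<and> fst G = ?N \<and> card (snd G) = card ?L}"
    by (simp add: cores_def)
  then have "of_nat (2 ^ M * fact M * card (cores n M)) =
      of_nat (2 ^ card ?L * fact (card ?L) * card {G. core G \<and> fst G = ?N \<and> card (snd G) = card ?L})"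
    by simp
  also have "\<dots> = (\<Sum>V\<in>Pow ?N. \<Sum>E\<in>Pow ?L. (\<Sum>P\<in>patchworks_on V E. (-1) ^ card P) *
      of_nat (card {f \<in> ((?L - E) \<times> (UNIV :: bool set)) \<rightarrow>\<^sub>E ?N.
        \<forall>v\<in>?N - V. 2 \<le> card {l \<in> (?L - E) \<times> UNIV. f l = v}}) :: rat)"
    by (rule card_cores_inclusion_exclusion) simp_all
  also have "\<dots> = (\<Sum>V\<in>Pow ?N. \<Sum>E\<in>Pow ?L. signed_patchworks (card V) (card E) * ?c (card V) (card E))"
  proof (intro sum.cong refl)
    fix V E assume VE: "V \<in> Pow ?N" "E \<in> Pow ?L"
    then have fin: "finite V" "finite E" by (auto intro: finite_subset)
    have "(\<Sum>P\<in>patchworks_on V E. (-1) ^ card P) = signed_patchworks (card V) (card E)"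
      unfolding signed_patchworks_def using fin by (rule sum_patchworks_on)
    moreover have "card ((?L - E) \<times> (UNIV :: bool set)) = 2 * (M - card E)"
      using VE fin by (simp add: card_cartesian_product card_Diff_subset)
    ultimately show "(\<Sum>P\<in>patchworks_on V E. (-1) ^ card P) *
        of_nat (card {f \<in> ((?L - E) \<times> (UNIV :: bool set)) \<rightarrow>\<^sub>E ?N.
          \<forall>v\<in>?N - V. 2 \<le> card {l \<in> (?L - E) \<times> UNIV. f l = v}}) =
        signed_patchworks (card V) (card E) * ?c (card V) (card E)"
      using VE card_min_degree_maps[of ?N V "(?L - E) \<times> (UNIV :: bool set)", where ?'a = rat]
      by (simp add: mult.commute[of 2])
  qed
  also have "\<dots> = (\<Sum>V\<in>Pow ?N. \<Sum>j\<le>M. of_nat (M choose j) *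
      (signed_patchworks (card V) j * ?c (card V) j))"
    using sum_card_Pow[of ?L "\<lambda>j. signed_patchworks k j * ?c k j" for k] by simp
  also have "\<dots> = (\<Sum>k\<le>n. of_nat (n choose k) * (\<Sum>j\<le>M. of_nat (M choose j) *
      (signed_patchworks k j * ?c k j)))"
    using sum_card_Pow[of ?N "\<lambda>k. \<Sum>j\<le>M. of_nat (M choose j) * (signed_patchworks k j * ?c k j)"] by simp
  finally show ?thesis .
qed

section \<open>Coefficients of the generating functions\<close>

text \<open>Substituting c z for z multiplies the coefficient of z^k by c^k; here c = e^x is
  constant in z.\<close>

lemma subst_patchwork_nth:
  "subst_zu Patchwork_gf (z_var * e_x) (-1) $ j $ k =
    fps_const (signed_patchworks k j / (2 ^ j * fact j * fact k)) * fps_exp 1 ^ k"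
proof -
  have "z_var * e_x = fps_const (fps_exp 1) * fps_X"
    by (simp add: z_var_def e_x_def mult.commute)
  then have "subst_zu Patchwork_gf (z_var * e_x) (-1) $ j $ k =
      fps_exp 1 ^ k * fps_const (poly (Patchwork_gf $ j $ k) (-1))"
    by (simp add: subst_zu_def)
  also have "poly (Patchwork_gf $ j $ k) (-1) = signed_patchworks k j / (2 ^ j * fact j * fact k)"
    by (simp add: Patchwork_gf_def poly_sum poly_monom signed_patchworks_def sum_divide_distrib)
  finally show ?thesis by (simp add: mult.commute)
qed

text \<open>Again a linear substitution, with c = e^x - 1 - x.\<close>

lemma exp_zx_nth:
  "exp_zx (z_var * (e_x - 1 - x_var)) $ k =
    fps_const (1 / fact k) * (fps_exp 1 - 1 - fps_X) ^ k"
proof -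
  have "z_var * (e_x - 1 - x_var) = fps_const (fps_exp 1 - 1 - fps_X) * fps_X"
    by (simp add: z_var_def e_x_def x_var_def mult.commute flip: fps_const_1_eq_1)
  then show ?thesis by (simp add: exp_zx_def)
qed

text \<open>In the theorem \<open>fact (2 * m)\<close> is itself a power series; this identifies it
  with the scalar it stands for.\<close>

lemma fact_mult_fps_nth:
  "(fact i * F :: 'a::{comm_semiring_1, semiring_char_0} fps) $ n = fact i * F $ n"
  by (metis fps_mult_left_const_nth fps_of_nat of_nat_fact)

theorem theorem8:
  shows "(\<lambda>m. fact (2 * m)
            * coeff_x (2 * m) (subst_zu Patchwork_gf (z_var * e_x) (-1)
                               * fps_const (exp_zx (z_var * (e_x - 1 - x_var))))
            * fps_const (fps_const (1 / (2 ^ m * fact m))) * fps_X ^ m)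
         sums Core_gf"
proof -
  define A where "A m = fact (2 * m)
    * coeff_x (2 * m) (subst_zu Patchwork_gf (z_var * e_x) (-1)
                       * fps_const (exp_zx (z_var * (e_x - 1 - x_var))))
    * fps_const (fps_const (1 / (2 ^ m * fact m)))" for m
  have A_nth: "A m $ j $ n = (\<Sum>k\<le>n. fact (2 * m) / (2 ^ m * fact m)
      * (signed_patchworks k j / (2 ^ j * fact j * fact k) * (1 / fact (n - k)))
      * (fps_exp 1 ^ k * (fps_exp 1 - 1 - fps_X) ^ (n - k)) $ (2 * m))" for m j n
  proof -
    have "(subst_zu Patchwork_gf (z_var * e_x) (-1)
          * fps_const (exp_zx (z_var * (e_x - 1 - x_var)))) $ j $ n =
        (\<Sum>k\<le>n. fps_const (signed_patchworks k j / (2 ^ j * fact j * fact k) * (1 / fact (n - k)))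
          * (fps_exp 1 ^ k * (fps_exp 1 - 1 - fps_X) ^ (n - k)))"
      unfolding fps_mult_right_const_nth fps_mult_nth[of _ _ n] atLeast0AtMost
        subst_patchwork_nth exp_zx_nth fps_const_mult[symmetric]
      by (intro sum.cong refl) (simp only: mult_ac)
    then have "A m $ j $ n = fact (2 * m) * (\<Sum>k\<le>n.
          signed_patchworks k j / (2 ^ j * fact j * fact k) * (1 / fact (n - k))
          * (fps_exp 1 ^ k * (fps_exp 1 - 1 - fps_X) ^ (n - k)) $ (2 * m)) * (1 / (2 ^ m * fact m))"
      unfolding A_def coeff_x_def by (simp add: fact_mult_fps_nth fps_sum_nth)
    then show ?thesis
      by (simp add: sum_distrib_left sum_distrib_right mult_ac divide_inverse)
  qed
  \<comment> \<open>The factor \<open>fps_X ^ m\<close>, kept out of \<open>A\<close>, supplies w^m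
    and the patchwork supplies w^(M - m), so the coefficient of w^M is a finite sum.\<close>
  have core_nth: "(\<Sum>m\<le>M. A m $ (M - m)) = Core_gf $ M" for M
  proof (rule fps_ext)
    fix n
    \<comment> \<open>The new index j = M - m counts the edges of the patchwork, as in
      \<open>card_cores_eq\<close>.\<close>
    have "(\<Sum>m\<le>M. A m $ (M - m)) $ n = (\<Sum>j\<le>M. A (M - j) $ j $ n)"
      unfolding fps_sum_nth by (rule sum.reindex_bij_witness[of _ "\<lambda>j. M - j" "\<lambda>j. M - j"]) auto
    also have "\<dots> = (\<Sum>k\<le>n. \<Sum>j\<le>M. fact (2 * (M - j)) / (2 ^ (M - j) * fact (M - j))
        * (signed_patchworks k j / (2 ^ j * fact j * fact k) * (1 / fact (n - k)))
        * (fps_exp 1 ^ k * (fps_exp 1 - 1 - fps_X) ^ (n - k)) $ (2 * (M - j)))"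
      unfolding A_nth by (rule sum.swap)
    \<comment> \<open>Termwise, (n choose k) / n! = 1 / (k! (n - k)!), likewise for M and j, and 2^M
      = 2^(M - j) 2^j.\<close>
    also have "\<dots> = (\<Sum>k\<le>n. \<Sum>j\<le>M. 1 / (2 ^ M * fact M * fact n) *
        (of_nat (n choose k) * (of_nat (M choose j) *
        (signed_patchworks k j * (fact (2 * (M - j)) *
        (fps_exp 1 ^ k * (fps_exp 1 - 1 - fps_X) ^ (n - k)) $ (2 * (M - j)))))))"
    proof (intro sum.cong refl)
      fix k j assume "k \<in> {..n}" "j \<in> {..M}"
      then have kj: "k \<le> n" "j \<le> M" by simp_all
      have "(2 :: rat) ^ M = 2 ^ (M - j) * 2 ^ j"
        using kj by (simp flip: power_add)
      then show "fact (2 * (M - j)) / (2 ^ (M - j) * fact (M - j))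
          * (signed_patchworks k j / (2 ^ j * fact j * fact k) * (1 / fact (n - k)))
          * (fps_exp 1 ^ k * (fps_exp 1 - 1 - fps_X) ^ (n - k)) $ (2 * (M - j)) =
        1 / (2 ^ M * fact M * fact n) *
        (of_nat (n choose k) * (of_nat (M choose j) *
        (signed_patchworks k j * (fact (2 * (M - j)) *
        (fps_exp 1 ^ k * (fps_exp 1 - 1 - fps_X) ^ (n - k)) $ (2 * (M - j))))))"
        using kj by (simp add: binomial_fact mult_ac)
    qed
    also have "\<dots> = 1 / (2 ^ M * fact M * fact n) * of_nat (2 ^ M * fact M * card (cores n M))"
      unfolding card_cores_eq by (simp only: sum_distrib_left)
    also have "\<dots> = Core_gf $ M $ n"
      by (simp add: Core_gf_def)
    finally show "(\<Sum>m\<le>M. A m $ (M - m)) $ n = Core_gf $ M $ n" .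
  qed
  \<comment> \<open>Convergence of formal power series: every coefficient of the partial sums is
    eventually constant, since terms with m > M do not reach w^M.\<close>
  have "(\<lambda>m. A m * fps_X ^ m) sums Core_gf"
    unfolding sums_def
  proof (rule tendsto_fpsI)
    fix M
    show "\<forall>\<^sub>F K in sequentially. (\<Sum>m<K. A m * fps_X ^ m) $ M = Core_gf $ M"
      using eventually_gt_at_top[of M]
    proof eventually_elim
      case (elim K)
      have "(\<Sum>m<K. A m * fps_X ^ m) $ M = (\<Sum>m<K. if M < m then 0 else A m $ (M - m))"
        by (simp add: fps_sum_nth fps_X_power_mult_right_nth)
      also have "\<dots> = (\<Sum>m\<le>M. A m $ (M - m))"
        using elim by (intro sum.mono_neutral_cong_right) auto
      finally show ?case by (simp add: core_nth)
    qed
  qed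
  then show ?thesis by (simp only: A_def)
qed

end
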